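(* Let $g_x^{(i)}, g_v^{(i)}, \rho_{x,1}^{(i)}, \rho_{x,-1}^{(i)}, \rho_{v,1}^{(i)}, \rho_{v,-1}^{(i)}$ ($i\in\{1,2,3\}$) be real numbers with $\rho^{(i)}_{x,1}+\rho^{(i)}_{x,-1}=-1$ and $\rho^{(i)}_{v,1}+\rho^{(i)}_{v,-1}=-1$ for each $i$. For each $n$ let $\mathbf M=\mathbf M_n$ be the $6n\times 6n$ matrix of the three-type nearest neighbor system on the circle with $N=3n$ vehicles (defined in the context). If any one of the following conditions is satisfied, then for all sufficiently large $N=3n$ the system $\frac{d}{dt}(\mathbf z,\dot{\mathbf z})^T=\mathbf M_n(\mathbf z,\dot{\mathbf z})^T$ is not linearly stable: (i) $g_x^{(1)}=0$ or $g_x^{(2)}=0$ or $g_x^{(3)}=0$. (ii) $\sum_{i=1}^3 E\big(g_x^{(i)},g_x^{(i+1)},\rho_{x,1}^{(i)},\rho_{x,1}^{(i+1)}\big)=0$. (iii) $g_x^{(1)}g_x^{(2)}g_x^{(3)}\left[\sum_{i=1}^3\beta_{x,1}^{(i)}+\prod_{i=1}^3\beta_{x,1}^{(i)}\right]\neq 0$.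
   Context: Superscripts are taken modulo 3 (so e.g. $g_x^{(4)}=g_x^{(1)}$, $\rho_{x,1}^{(4)}=\rho_{x,1}^{(1)}$). Notation: $E(a,b,c,d)=ab(1+c+cd)$, and $\beta_{x,1}^{(i)}=\rho_{x,1}^{(i)}-\rho_{x,-1}^{(i)}$. The system: there are $n$ vehicles of each of three types, $N=3n$ in total, with $\mathbf z^{(i)}=(z^{(i)}_1,\dots,z^{(i)}_n)$ the deviations from equilibrium positions of the vehicles of type $i$. With indices $j$ taken modulo $n$ (system "on the circle", i.e. periodic boundary conditions), the equations of motion are $$\ddot z^{(1)}_j=g^{(1)}_x\big(z^{(1)}_j+\rho^{(1)}_{x,1}z^{(2)}_j+\rho^{(1)}_{x,-1}z^{(3)}_{j-1}\big)+g^{(1)}_v\big(\dot z^{(1)}_j+\rho^{(1)}_{v,1}\dot z^{(2)}_j+\rho^{(1)}_{v,-1}\dot z^{(3)}_{j-1}\big),$$ $$\ddot z^{(2)}_j=g^{(2)}_x\big(z^{(2)}_j+\rho^{(2)}_{x,1}z^{(3)}_j+\rho^{(2)}_{x,-1}z^{(1)}_{j}\big)+g^{(2)}_v\big(\dot z^{(2)}_j+\rho^{(2)}_{v,1}\dot z^{(3)}_j+\rho^{(2)}_{v,-1}\dot z^{(1)}_{j}\big),$$ $$\ddot z^{(3)}_j=g^{(3)}_x\big(z^{(3)}_j+\rho^{(3)}_{x,1}z^{(1)}_{j+1}+\rho^{(3)}_{x,-1}z^{(2)}_{j}\big)+g^{(3)}_v\big(\dot z^{(3)}_j+\rho^{(3)}_{v,1}\dot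 z^{(1)}_{j+1}+\rho^{(3)}_{v,-1}\dot z^{(2)}_{j}\big).$$ $\mathbf M_n$ is the $6n\times 6n$ matrix of the equivalent first-order linear system $\frac{d}{dt}(\mathbf z,\dot{\mathbf z})^T=\mathbf M_n(\mathbf z,\dot{\mathbf z})^T$ with $\mathbf z=(\mathbf z^{(1)},\mathbf z^{(2)},\mathbf z^{(3)})$. Linear stability: the system is called linearly stable if its matrix has the eigenvalue zero with geometric multiplicity one and algebraic multiplicity two, and all other eigenvalues have real part less than zero. *)

theory Defs
  imports
    Complex_Main
    "Jordan_Normal_Form.Char_Poly"
    "Jordan_Normal_Form.Matrix_Kernel"
begin

section \<open>The three-type nearest neighbour system on the circle\<close>

text \<open>
  A family with a superscript \<open>i \<in> {1,2,3}\<close> is a function on \<open>nat\<close> of which only the values at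
  \<open>1\<close>, \<open>2\<close>, \<open>3\<close> matter; \<open>next3\<close> is the cyclic successor on \<open>{1,2,3}\<close>. Vehicles of a type are
  numbered \<open>j = 0, \<dots>, n - 1\<close> (instead of \<open>1, \<dots>, n\<close>), with indices modulo \<open>n\<close>.
  A parameter with second subscript \<open>1\<close> or \<open>-1\<close> carries the suffix \<open>p\<close> or \<open>m\<close>.
\<close>

definition next3 :: "nat \<Rightarrow> nat" where
  "next3 i = i mod 3 + 1"

text \<open>
  The sum of the three neighbouring terms in the equation of motion of vehicle \<open>j\<close> of type \<open>i\<close>,
  used both for positions and for velocities. Since \<open>nat\<close> subtraction truncates, \<open>j - 1\<close> modulo \<open>n\<close>
  is written \<open>(j + n - 1) mod n\<close>.
\<close>

definition interaction ::
  "nat \<Rightarrow> (nat \<Rightarrow> real) \<Rightarrow> (nat \<Rightarrow> real) \<Rightarrow> (nat \<Rightarrow> nat \<Rightarrow> real) \<Rightarrow> nat \<Rightarrow> nat \<Rightarrow> real" where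
  "interaction n \<rho>p \<rho>m y i j =
    (if i = 1 then y 1 j + \<rho>p 1 * y 2 j + \<rho>m 1 * y 3 ((j + n - 1) mod n)
     else if i = 2 then y 2 j + \<rho>p 2 * y 3 j + \<rho>m 2 * y 1 j
     else y 3 j + \<rho>p 3 * y 1 ((j + 1) mod n) + \<rho>m 3 * y 2 j)"

definition acceleration ::
  "(nat \<Rightarrow> real) \<Rightarrow> (nat \<Rightarrow> real) \<Rightarrow> (nat \<Rightarrow> real) \<Rightarrow> (nat \<Rightarrow> real) \<Rightarrow> (nat \<Rightarrow> real) \<Rightarrow> (nat \<Rightarrow> real) \<Rightarrow>
   nat \<Rightarrow> (nat \<Rightarrow> nat \<Rightarrow> real) \<Rightarrow> (nat \<Rightarrow> nat \<Rightarrow> real) \<Rightarrow> nat \<Rightarrow> nat \<Rightarrow> real" where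
  "acceleration gx gv \<rho>xp \<rho>xm \<rho>vp \<rho>vm n z w i j =
    gx i * interaction n \<rho>xp \<rho>xm z i j + gv i * interaction n \<rho>vp \<rho>vm w i j"

text \<open>
  State vectors of length \<open>6n\<close> consist of six blocks of length \<open>n\<close>: the positions of types 1, 2, 3,
  followed by the velocities of types 1, 2, 3.
\<close>

definition position :: "nat \<Rightarrow> real vec \<Rightarrow> nat \<Rightarrow> nat \<Rightarrow> real" where
  "position n u i j = u $ ((i - 1) * n + j)"

definition velocity :: "nat \<Rightarrow> real vec \<Rightarrow> nat \<Rightarrow> nat \<Rightarrow> real" where
  "velocity n u i j = u $ (3 * n + (i - 1) * n + j)"

definition system_rhs ::
  "(nat \<Rightarrow> real) \<Rightarrow> (nat \<Rightarrow> real) \<Rightarrow> (nat \<Rightarrow> real) \<Rightarrow> (nat \<Rightarrow> real) \<Rightarrow> (nat \<Rightarrow> real) \<Rightarrow> (nat \<Rightarrow> real) \<Rightarrow>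
   nat \<Rightarrow> real vec \<Rightarrow> real vec" where
  "system_rhs gx gv \<rho>xp \<rho>xm \<rho>vp \<rho>vm n u = vec (6 * n) (\<lambda>r.
    if r < 3 * n then u $ (3 * n + r)
    else acceleration gx gv \<rho>xp \<rho>xm \<rho>vp \<rho>vm n (position n u) (velocity n u)
           ((r - 3 * n) div n + 1) ((r - 3 * n) mod n))"

text \<open>
  The matrix of the linear map \<open>system_rhs\<close>: its columns are the images of the unit vectors; see
  lemmas \<open>system_matrix_mult\<close>, \<open>position_system_matrix\<close> and \<open>velocity_system_matrix\<close> below.
\<close>

definition system_matrix ::
  "(nat \<Rightarrow> real) \<Rightarrow> (nat \<Rightarrow> real) \<Rightarrow> (nat \<Rightarrow> real) \<Rightarrow> (nat \<Rightarrow> real) \<Rightarrow> (nat \<Rightarrow> real) \<Rightarrow> (nat \<Rightarrow> real) \<Rightarrow>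
   nat \<Rightarrow> real mat" where
  "system_matrix gx gv \<rho>xp \<rho>xm \<rho>vp \<rho>vm n = mat (6 * n) (6 * n) (\<lambda>(r, c).
    system_rhs gx gv \<rho>xp \<rho>xm \<rho>vp \<rho>vm n (unit_vec (6 * n) c) $ r)"

lemma system_matrix_carrier [simp]:
  "system_matrix gx gv \<rho>xp \<rho>xm \<rho>vp \<rho>vm n \<in> carrier_mat (6 * n) (6 * n)"
  by (simp add: system_matrix_def)

lemma vec_index_eq_sum_unit:
  fixes u :: "real vec"
  assumes "k < N"
  shows "(\<Sum>c<N. unit_vec N c $ k * u $ c) = u $ k"
proof -
  have "(\<Sum>c<N. unit_vec N c $ k * u $ c) = (\<Sum>c<N. if c = k then u $ c else 0)"
    using assms by (intro sum.cong) auto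
  also have "\<dots> = u $ k"
    using assms by simp
  finally show ?thesis .
qed

lemma state_index_less:
  fixes i j n :: nat
  assumes "i \<in> {1, 2, 3}" and "j < n"
  shows "(i - 1) * n + j < 3 * n"
  using assms by auto

lemma position_eq_sum:
  assumes "i \<in> {1, 2, 3}" and "j < n"
  shows "(\<Sum>c<6 * n. position n (unit_vec (6 * n) c) i j * u $ c) = position n u i j"
  unfolding position_def
  using state_index_less[OF assms] by (intro vec_index_eq_sum_unit) linarith

lemma velocity_eq_sum:
  assumes "i \<in> {1, 2, 3}" and "j < n"
  shows "(\<Sum>c<6 * n. velocity n (unit_vec (6 * n) c) i j * u $ c) = velocity n u i j"
  unfolding velocity_def
  using state_index_less[OF assms] by (intro vec_index_eq_sum_unit) linarith

lemma interaction_eq_sum: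
  assumes "\<And>i j. i \<in> {1, 2, 3} \<Longrightarrow> j < n \<Longrightarrow> (\<Sum>c<K. Y c i j * a c) = y i j"
    and "i \<in> {1, 2, 3}" and "j < n"
  shows "(\<Sum>c<K. interaction n \<rho>p \<rho>m (Y c) i j * a c) = interaction n \<rho>p \<rho>m y i j"
proof -
  have n: "(j + n - 1) mod n < n" "(j + 1) mod n < n"
    using assms(3) by (simp_all del: One_nat_def)
  have lin: "(\<Sum>c<K. (Y c i1 j1 + p * Y c i2 j2 + q * Y c i3 j3) * a c)
      = y i1 j1 + p * y i2 j2 + q * y i3 j3"
    if "i1 \<in> {1, 2, 3}" "i2 \<in> {1, 2, 3}" "i3 \<in> {1, 2, 3}" "j1 < n" "j2 < n" "j3 < n"
    for i1 i2 i3 j1 j2 j3 p q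
    unfolding assms(1)[OF that(1,4), symmetric] assms(1)[OF that(2,5), symmetric]
      assms(1)[OF that(3,6), symmetric]
    by (simp add: sum.distrib sum_distrib_left algebra_simps)
  show ?thesis
    using assms(2,3) n by (auto simp: interaction_def lin)
qed

lemma system_matrix_mult:
  assumes u: "u \<in> carrier_vec (6 * n)"
  shows "system_matrix gx gv \<rho>xp \<rho>xm \<rho>vp \<rho>vm n *\<^sub>v u = system_rhs gx gv \<rho>xp \<rho>xm \<rho>vp \<rho>vm n u"
    (is "?M *\<^sub>v u = ?F u")
proof (rule eq_vecI)
  fix r assume "r < dim_vec (?F u)"
  then have r: "r < 6 * n"
    by (simp add: system_rhs_def)
  have "(?M *\<^sub>v u) $ r = (\<Sum>c<6 * n. ?F (unit_vec (6 * n) c) $ r * u $ c)"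
    using r u by (simp add: system_matrix_def scalar_prod_def lessThan_atLeast0)
  also have "\<dots> = ?F u $ r"
  proof (cases "r < 3 * n")
    case True
    then show ?thesis
      using r by (simp add: system_rhs_def vec_index_eq_sum_unit del: index_unit_vec)
  next
    case False
    define i where "i = (r - 3 * n) div n + 1"
    define j where "j = (r - 3 * n) mod n"
    have F: "?F v $ r = gx i * interaction n \<rho>xp \<rho>xm (position n v) i j
        + gv i * interaction n \<rho>vp \<rho>vm (velocity n v) i j" for v
      using r False by (simp add: system_rhs_def acceleration_def i_def j_def)
    have n: "n > 0" using r by simp
    have "(r - 3 * n) div n < 3"
      using r False n by (simp add: less_mult_imp_div_less)
    then have i: "i \<in> {1, 2, 3}" by (auto simp: i_def)
    have j: "j < n" using n by (simp add: j_def)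
    have "(\<Sum>c<6 * n. ?F (unit_vec (6 * n) c) $ r * u $ c) =
      gx i * (\<Sum>c<6 * n. interaction n \<rho>xp \<rho>xm (position n (unit_vec (6 * n) c)) i j * u $ c) +
      gv i * (\<Sum>c<6 * n. interaction n \<rho>vp \<rho>vm (velocity n (unit_vec (6 * n) c)) i j * u $ c)"
      by (simp add: F sum_distrib_left sum.distrib distrib_right mult.assoc)
    also have "\<dots> = gx i * interaction n \<rho>xp \<rho>xm (position n u) i j
        + gv i * interaction n \<rho>vp \<rho>vm (velocity n u) i j"
      by (intro arg_cong2[where f = "(+)"] arg_cong2[where f = "(*)"] refl
          interaction_eq_sum position_eq_sum velocity_eq_sum i j)
    also have "\<dots> = ?F u $ r"
      by (simp add: F)
    finally show ?thesis .
  qed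
  finally show "(?M *\<^sub>v u) $ r = ?F u $ r" .
qed (simp add: system_matrix_def system_rhs_def)

lemma position_system_matrix:
  assumes "u \<in> carrier_vec (6 * n)" and "i \<in> {1, 2, 3}" and "j < n"
  shows "position n (system_matrix gx gv \<rho>xp \<rho>xm \<rho>vp \<rho>vm n *\<^sub>v u) i j = velocity n u i j"
  using state_index_less[OF assms(2,3)]
  by (simp add: system_matrix_mult[OF assms(1)] position_def velocity_def system_rhs_def add.assoc)

lemma velocity_system_matrix:
  assumes "u \<in> carrier_vec (6 * n)" and "i \<in> {1, 2, 3}" and "j < n"
  shows "velocity n (system_matrix gx gv \<rho>xp \<rho>xm \<rho>vp \<rho>vm n *\<^sub>v u) i j =
    acceleration gx gv \<rho>xp \<rho>xm \<rho>vp \<rho>vm n (position n u) (velocity n u) i j"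
proof -
  define k where "k = (i - 1) * n + j"
  have "k div n + 1 = i" "k mod n = j"
    using assms(2,3) by (auto simp: k_def)
  moreover have "k < 3 * n"
    using state_index_less[OF assms(2,3)] by (simp add: k_def)
  moreover have "velocity n v i j = v $ (3 * n + k)" for v
    by (simp add: velocity_def k_def add.assoc)
  ultimately show ?thesis
    by (simp add: system_matrix_mult[OF assms(1)] system_rhs_def)
qed

section \<open>Linear stability\<close>

text \<open>
  Eigenvalues of the real matrix are taken over the complex numbers. The algebraic multiplicity of
  the eigenvalue \<open>0\<close> is its order as a root of the characteristic polynomial, the geometric one
  is the dimension of its eigenspace, the kernel of \<open>char_matrix A 0 = A - 0 I\<close>.
\<close>

definition algebraic_mult :: "complex mat \<Rightarrow> complex \<Rightarrow> nat" where
  "algebraic_mult A \<mu> = Polynomial.order \<mu> (char_poly A)"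

definition geometric_mult :: "complex mat \<Rightarrow> complex \<Rightarrow> nat" where
  "geometric_mult A \<mu> = kernel_dim (char_matrix A \<mu>)"

definition linearly_stable :: "real mat \<Rightarrow> bool" where
  "linearly_stable M \<longleftrightarrow>
    (let A = map_mat complex_of_real M in
      eigenvalue A 0 \<and> geometric_mult A 0 = 1 \<and> algebraic_mult A 0 = 2 \<and>
      (\<forall>\<mu>. eigenvalue A \<mu> \<and> \<mu> \<noteq> 0 \<longrightarrow> Re \<mu> < 0))"

section \<open>Notation of the instability conditions\<close>

definition E_term :: "real \<Rightarrow> real \<Rightarrow> real \<Rightarrow> real \<Rightarrow> real" where
  "E_term a b c d = a * b * (1 + c + c * d)"

definition beta :: "(nat \<Rightarrow> real) \<Rightarrow> (nat \<Rightarrow> real) \<Rightarrow> nat \<Rightarrow> real" where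
  "beta \<rho>p \<rho>m i = \<rho>p i - \<rho>m i"

end

theory Submission
  imports Defs
begin

text \<open>
  A mode \<open>z i j = a i * \<omega> ^ j\<close> with \<open>\<omega> ^ n = 1\<close> turns the system into a \<open>3 \<times> 3\<close> quadratic eigenvalue problem,
  whose determinant is a polynomial \<open>P(\<omega>)\<close> of degree six in the eigenvalue \<open>\<mu>\<close>.

  If some \<open>gx i\<close> vanishes, then \<open>P(\<omega>)\<close> vanishes at \<open>0\<close> for every \<open>\<omega>\<close>, so besides the constants there is
  a kernel vector with \<open>\<omega> \<noteq> 1\<close> and the eigenvalue \<open>0\<close> is not geometrically simple.

  At \<open>\<omega> = 1\<close> the constants provide a Jordan chain \<open>(1, 0), (0, 1)\<close> for the eigenvalue \<open>0\<close>. The sum of the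
  \<open>E\<close> terms is the obstruction to extending it by a vector \<open>(z, 0)\<close>; if it vanishes, either the
  extension exists and the algebraic multiplicity is at least three, or the kernel is too large.

  In the remaining case put \<open>\<omega> = cis \<phi>\<close> and \<open>\<mu> = sqrt \<phi> x\<close> with \<open>\<phi> = 2 \<pi> / n\<close>. Then \<open>P(\<omega>)(\<mu>) / \<phi>\<close> tends
  to \<open>c x\<^sup>2 - \<i> d\<close> with real \<open>c, d \<noteq> 0\<close>, whose two roots lie on opposite sides of the imaginary axis. A
  polynomial with all roots in the closed left half plane satisfies \<open>|p(- cnj x)| \<le> |p(x)|\<close> whenever
  \<open>Re x \<ge> 0\<close>. This inequality passes to the limit and is violated there by the root \<open>x\<close> with
  \<open>Re x > 0\<close>.
\<close>

section \<open>Linear algebra\<close>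

text \<open>The determinant with rows \<open>(a, b, c)\<close>, \<open>(d, e, f)\<close>,
  \<open>(g, h, i)\<close>, written out so that real, complex and polynomial entries are treated
  alike.\<close>

definition det3 :: "'a::comm_ring_1 \<Rightarrow> 'a \<Rightarrow> 'a \<Rightarrow> 'a \<Rightarrow> 'a \<Rightarrow> 'a \<Rightarrow> 'a \<Rightarrow> 'a \<Rightarrow> 'a \<Rightarrow> 'a" where
  "det3 a b c d e f g h i =
    a * (e * i - f * h) - b * (d * i - f * g) + c * (d * h - e * g)"

lemma det2_zero_kernel:
  fixes p q r s :: "'a::field"
  assumes "p * s = q * r"
  obtains y z where "y \<noteq> 0 \<or> z \<noteq> 0" "p * y + q * z = 0" "r * y + s * z = 0"
proof -
  consider "p \<noteq> 0 \<or> q \<noteq> 0" | "p = 0" "q = 0" "r \<noteq> 0 \<or> s \<noteq> 0" | "p = 0" "q = 0" "r = 0" "s = 0"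
    by blast
  then show thesis
  proof cases
    case 1
    then show ?thesis using that[of "- q" p] assms by (auto simp: algebra_simps)
  next
    case 2
    then show ?thesis using that[of "- s" r] by (auto simp: algebra_simps)
  next
    case 3
    then show ?thesis using that[of 1 0] by auto
  qed
qed

text \<open>Eliminating \<open>x\<close> with the pivot \<open>a\<close> leaves a 2x2 system in
  \<open>y\<close>, \<open>z\<close> whose determinant is \<open>a\<close> times the 3x3
  one.\<close>

lemma det3_zero_kernel_pivot:
  fixes a b c d e f g h i :: "'a::field"
  assumes "det3 a b c d e f g h i = 0" and a: "a \<noteq> 0"
  shows "\<exists>x y z. (x \<noteq> 0 \<or> y \<noteq> 0 \<or> z \<noteq> 0) \<and>
    a * x + b * y + c * z = 0 \<and> d * x + e * y + f * z = 0 \<and> g * x + h * y + i * z = 0"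
proof -
  have "(a * e - b * d) * (a * i - c * g) - (a * f - c * d) * (a * h - b * g)
      = a * det3 a b c d e f g h i"
    by (simp add: det3_def algebra_simps)
  then have "(a * e - b * d) * (a * i - c * g) = (a * f - c * d) * (a * h - b * g)"
    using assms(1) by simp
  then obtain y z where yz: "y \<noteq> 0 \<or> z \<noteq> 0"
    "(a * e - b * d) * y + (a * f - c * d) * z = 0" "(a * h - b * g) * y + (a * i - c * g) * z = 0"
    by (rule det2_zero_kernel)
  define x where "x = - (b * y + c * z) / a"
  have x: "a * x = - (b * y + c * z)"
    using a by (simp add: x_def)
  have "a * (d * x + e * y + f * z) = d * (a * x) + a * (e * y + f * z)"
    by (simp add: algebra_simps)
  also have "\<dots> = 0"
    using yz(2) unfolding x by (simp add: algebra_simps)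
  finally have "d * x + e * y + f * z = 0" using a by simp
  moreover have "a * (g * x + h * y + i * z) = g * (a * x) + a * (h * y + i * z)"
    by (simp add: algebra_simps)
  then have "a * (g * x + h * y + i * z) = 0"
    using yz(3) unfolding x by (simp add: algebra_simps)
  then have "g * x + h * y + i * z = 0" using a by simp
  moreover have "a * x + b * y + c * z = 0" by (simp add: x)
  ultimately show ?thesis using yz(1) by blast
qed

text \<open>Cyclic row permutations keep the determinant, so any nonzero entry of the first column
  can serve as pivot; if that column is zero, \<open>(1, 0, 0)\<close> is in the kernel.\<close>

lemma det3_zero_kernel:
  fixes a b c d e f g h i :: "'a::field"
  assumes det: "det3 a b c d e f g h i = 0"
  obtains x y z where "x \<noteq> 0 \<or> y \<noteq> 0 \<or> z \<noteq> 0"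
    "a * x + b * y + c * z = 0" "d * x + e * y + f * z = 0" "g * x + h * y + i * z = 0"
proof -
  have "det3 d e f g h i a b c = 0" "det3 g h i a b c d e f = 0"
    using det by (simp_all add: det3_def algebra_simps)
  then consider "a = 0" "d = 0" "g = 0" | "\<exists>x y z. (x \<noteq> 0 \<or> y \<noteq> 0 \<or> z \<noteq> 0) \<and>
    a * x + b * y + c * z = 0 \<and> d * x + e * y + f * z = 0 \<and> g * x + h * y + i * z = 0"
    using det3_zero_kernel_pivot[of a b c d e f g h i] det3_zero_kernel_pivot[of d e f g h i a b c]
      det3_zero_kernel_pivot[of g h i a b c d e f] det
    by blast
  then show thesis
  proof cases
    case 1
    then show ?thesis using that[of 1 0 0] by simp
  next
    case 2
    then show ?thesis using that by blast
  qed
qed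

lemma poly_det3:
  "poly (det3 a b c d e f g h i) x = det3 (poly a x) (poly b x) (poly c x)
    (poly d x) (poly e x) (poly f x) (poly g x) (poly h x) (poly i x)"
  by (simp add: det3_def)

section \<open>Geometric and algebraic multiplicity\<close>

lemma geometric_mult_1_eigenspace:
  fixes A :: "complex mat"
  assumes A: "A \<in> carrier_mat n n" and "geometric_mult A \<mu> = 1"
  obtains b where "\<And>v. v \<in> carrier_vec n \<Longrightarrow> A *\<^sub>v v = \<mu> \<cdot>\<^sub>v v \<Longrightarrow> \<exists>c. v = c \<cdot>\<^sub>v b"
proof -
  let ?C = "char_matrix A \<mu>"
  have C: "?C \<in> carrier_mat n n" using A by simp
  interpret K: kernel n n ?C by unfold_locales (rule C)
  obtain B where B: "finite B" "K.basis B" using kernel_basis_exists[OF C] by blast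
  have "card B = 1"
    using K.Ker.dim_basis[OF B] assms(2) by (simp add: geometric_mult_def)
  then obtain b where b: "B = {b}" by (auto simp: card_1_singleton_iff)
  have bk: "B \<subseteq> mat_kernel ?C" and gen: "K.span B = mat_kernel ?C"
    using B(2) by (auto simp: K.Ker.basis_def)
  have bn: "b \<in> carrier_vec n" using bk b mat_kernel_carrier[OF C] by auto
  have "\<exists>c. v = c \<cdot>\<^sub>v b" if v: "v \<in> carrier_vec n" and ev: "A *\<^sub>v v = \<mu> \<cdot>\<^sub>v v" for v
  proof -
    have "v \<in> mat_kernel ?C"
    proof (cases "v = 0\<^sub>v n")
      case True
      then show ?thesis using C by (intro mat_kernelI) auto
    next
      case False
      then have "eigenvector A v \<mu>" using A v ev by (simp add: eigenvector_def)
      then show ?thesis using C by (intro mat_kernelI) (auto simp: eigenvector_char_matrix[OF A])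
    qed
    then have "v \<in> K.span B" using gen by simp
    then obtain a where a: "v = K.lincomb a B"
      using K.Ker.finite_in_span[OF B(1)] bk by auto
    have "v = a b \<cdot>\<^sub>v b"
      using v bn K.lincomb_index[OF _ bk, of _ a] by (intro eq_vecI) (auto simp: a b)
    then show ?thesis ..
  qed
  then show thesis by (rule that)
qed

lemma jordan_chain_order_char_poly:
  fixes A :: "'a::field mat" and v :: "nat \<Rightarrow> 'a vec"
  assumes A: "A \<in> carrier_mat n n"
    and v: "\<And>m. v m \<in> carrier_vec n"
    and v0: "A *\<^sub>v v 0 = 0\<^sub>v n" "v 0 \<noteq> 0\<^sub>v n"
    and v_Suc: "\<And>m. m < k \<Longrightarrow> A *\<^sub>v v (Suc m) = v m"
  shows "Suc k \<le> Polynomial.order 0 (char_poly A)"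
proof -
  \<comment> \<open>The polynomial vector \<open>w = \<Sum>m\<le>k. x ^ m v m\<close> satisfies \<open>(x - A) w = x ^ Suc k v k\<close>; Cramer's rule
    for this system shows that \<open>x ^ Suc k\<close> divides an entry of \<open>w\<close> times \<open>char_poly A\<close>.\<close>
  let ?C = "char_poly_matrix A"
  have C: "?C \<in> carrier_mat n n" using A by simp
  define w where "w = vec n (\<lambda>i. \<Sum>m<Suc k. Polynomial.monom (v m $ i) m)"
  have w: "w \<in> carrier_vec n" by (simp add: w_def)
  have vA: "(\<Sum>j<n. A $$ (i, j) * v m $ j) = (A *\<^sub>v v m) $ i" if "i < n" for i m
    using that A v[of m] by (simp add: scalar_prod_def lessThan_atLeast0)
  have Cw: "(?C *\<^sub>v w) $ i = Polynomial.monom (v k $ i) (Suc k)" if i: "i < n" for i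
  proof -
    have "(?C *\<^sub>v w) $ i = (\<Sum>j<n. ((if i = j then [:0, 1:] else 0) + [:- A $$ (i, j):]) * w $ j)"
      using i A C w
      by (auto simp: scalar_prod_def lessThan_atLeast0 char_poly_matrix_def intro!: sum.cong)
    also have "\<dots> = [:0, 1:] * w $ i - (\<Sum>j<n. [:A $$ (i, j):] * w $ j)"
      using i by (simp add: distrib_right sum.distrib if_distrib[of "\<lambda>x. x * _"] sum_negf
          sum_subtractf           cong: if_cong)
    also have "(\<Sum>j<n. [:A $$ (i, j):] * w $ j)
        = (\<Sum>j<n. \<Sum>m<Suc k. Polynomial.monom (A $$ (i, j) * v m $ j) m)"
      by (intro sum.cong refl) (simp add: w_def smult_sum2 smult_monom del: sum.lessThan_Suc)
    also have "\<dots> = (\<Sum>m<Suc k. Polynomial.monom ((A *\<^sub>v v m) $ i) m)"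
      by (subst sum.swap) (simp add: vA[OF i, symmetric] Polynomial.monom_sum del: sum.lessThan_Suc)
    \<comment> \<open>The term \<open>m = 0\<close> drops out because \<open>v 0\<close> is in the
      kernel; the others shift by one and cancel against \<open>[:0, 1:] * w $ i\<close> except for
      its top term.\<close>
    also have "\<dots> = (\<Sum>m<k. Polynomial.monom (v m $ i) (Suc m))"
      using i v0 v_Suc by (simp add: sum.lessThan_Suc_shift del: sum.lessThan_Suc)
    also have "[:0, 1:] * w $ i = (\<Sum>m<Suc k. Polynomial.monom (v m $ i) (Suc m))"
      using i by (simp add: w_def monom_Suc sum_distrib_left del: sum.lessThan_Suc)
    finally show ?thesis by simp
  qed
  obtain r where r: "r < n" "v 0 $ r \<noteq> 0"
    using v0(2) v[of 0] by (metis carrier_vecD eq_vecI index_zero_vec)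
  let ?B = "replace_col ?C (?C *\<^sub>v w) r"
  have B: "?B \<in> carrier_mat n n" using C by (auto simp: replace_col_def)
  have "det ?B = (\<Sum>i<n. ?B $$ (i, r) * cofactor ?B i r)"
    using laplace_expansion_column[OF B r(1)] .
  moreover have "[:0, 1:] ^ Suc k dvd ?B $$ (i, r)" if "i < n" for i
  proof -
    have "?B $$ (i, r) = Polynomial.monom (v k $ i) (Suc k)"
      using that r C Cw[OF that] by (auto simp: replace_col_def)
    also have "\<dots> = [:0, 1:] ^ Suc k * [:v k $ i:]"
      by (simp add: monom_altdef mult.commute del: power_Suc)
    finally show ?thesis by (simp only: dvd_triv_left)
  qed
  ultimately have "[:0, 1:] ^ Suc k dvd det ?B"
    by (auto intro!: dvd_sum dvd_mult2)
  then have dvd: "[:- 0, 1:] ^ Suc k dvd w $ r * char_poly A"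
    using cramer_lemma_mat[OF C w r(1)] by (simp add: char_poly_def)
  \<comment> \<open>Since \<open>w $ r\<close> does not vanish at \<open>0\<close>, the whole power
    \<open>x ^ Suc k\<close> must divide \<open>char_poly A\<close>.\<close>
  have w0: "poly (w $ r) 0 = v 0 $ r"
    using r by (simp add: w_def poly_monom sum.lessThan_Suc_shift poly_sum del: sum.lessThan_Suc)
  have "char_poly A \<noteq> 0"
    using degree_monic_char_poly[OF A] by auto
  moreover have "w $ r \<noteq> 0" using w0 r by auto
  ultimately have "Suc k \<le> Polynomial.order 0 (w $ r) + Polynomial.order 0 (char_poly A)"
    using dvd unfolding order_divides by (simp add: order_mult)
  moreover have "Polynomial.order 0 (w $ r) = 0"
    using w0 r by (intro order_0I) simp
  ultimately show ?thesis by simp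
qed

section \<open>Location of roots and limits\<close>

text \<open>The mirror image \<open>- cnj x\<close> of \<open>x\<close> in the imaginary axis is at
  least as close as \<open>x\<close> to every root in the closed left half plane. Multiplying over
  the linear factors gives the claim.\<close>

lemma poly_norm_reflect_le:
  fixes p :: "complex poly"
  assumes roots: "\<And>a. poly p a = 0 \<Longrightarrow> Re a \<le> 0" and x: "Re x \<ge> 0"
  shows "cmod (poly p (- cnj x)) \<le> cmod (poly p x)"
proof (cases "p = 0")
  case False
  obtain as where p: "p = Polynomial.smult (coeff p (degree p)) (\<Prod>a\<leftarrow>as. [:- a, 1:])"
    using fundamental_theorem_algebra_factorized[of p] by metis
  have roots': "Re a \<le> 0" if "a \<in> set as" for a
    using that by (intro roots, subst p) (auto simp: poly_prod_list prod_list_zero_iff image_iff)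
  have "cmod (poly (\<Prod>a\<leftarrow>as. [:- a, 1:]) (- cnj x)) \<le> cmod (poly (\<Prod>a\<leftarrow>as. [:- a, 1:]) x)"
    using roots'
  proof (induction as)
    case (Cons a as)
    \<comment> \<open>The squares of the two moduli compared below differ by
      \<open>- 4 * Re x * Re a\<close>.\<close>
    have "Re x * Re a \<le> 0"
      using x Cons.prems[of a] by (simp add: mult_nonneg_nonpos)
    then have "cmod (- cnj x - a) \<le> cmod (x - a)"
      by (simp add: cmod_def power2_eq_square algebra_simps)
    moreover have "poly (\<Prod>b\<leftarrow>a # as. [:- b, 1:]) y = (y - a) * poly (\<Prod>b\<leftarrow>as. [:- b, 1:]) y" for y
      by (simp add: algebra_simps)
    ultimately show ?case using Cons by (simp only: norm_mult) (auto intro!: mult_mono)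
  qed simp
  then show ?thesis
    by (subst (1 2) p) (simp add: norm_mult mult_left_mono)
qed simp

lemma tendsto_cis_quotient:
  fixes \<phi> :: "nat \<Rightarrow> real"
  assumes "\<phi> \<longlonglongrightarrow> 0" and "\<And>n. \<phi> n \<noteq> 0"
  shows "(\<lambda>n. (cis (\<phi> n) - 1) / of_real (\<phi> n)) \<longlonglongrightarrow> \<i>"
proof -
  have "filterlim (\<lambda>n. \<i> * of_real (\<phi> n)) (at 0) sequentially"
    using assms by (auto simp: filterlim_at intro!: tendsto_eq_intros)
  from filterlim_compose[OF lim_exp_minus_1 this]
  have "(\<lambda>n. (cis (\<phi> n) - 1) / (\<i> * of_real (\<phi> n))) \<longlonglongrightarrow> 1"
    by (simp add: cis_conv_exp)
  from tendsto_mult_left[OF this, of \<i>] show ?thesis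
    by (simp add: divide_simps)
qed

section \<open>Determinant identities for the parameters\<close>

text \<open>Adding the other two columns to the first preserves the determinant; the factor
  \<open>s\<close> then comes out of the first column.\<close>

lemma det3_scaled_column_sum:
  "det3 a b c d e f g h i = s * det3 x b c y e f z h i"
  if "a + b + c = s * x" "d + e + f = s * y" "g + h + i = s * z"
proof -
  have "det3 a b c d e f g h i = det3 (a + b + c) b c (d + e + f) e f (g + h + i) h i"
    by (simp add: det3_def algebra_simps)
  also have "\<dots> = s * det3 x b c y e f z h i"
    unfolding that by (simp add: det3_def algebra_simps)
  finally show ?thesis .
qed

lemma next3: "next3 1 = 2" "next3 2 = 3" "next3 3 = 1"
  by (simp_all add: next3_def)

text \<open>The right side is the determinant of the position coefficients with the first column
  replaced by ones.\<close>

lemma E_term_sum_eq: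
  assumes \<rho>: "\<forall>i\<in>{1, 2, 3}. \<rho>p i + \<rho>m i = -1"
  shows "(\<Sum>i\<in>{1, 2, 3}. E_term (g i) (g (next3 i)) (\<rho>p i) (\<rho>p (next3 i)))
    = det3 1 (g 1 * \<rho>p 1) (g 1 * \<rho>m 1) 1 (g 2) (g 2 * \<rho>p 2) 1 (g 3 * \<rho>m 3) (g 3)"
proof -
  have m: "\<rho>m 1 = - 1 - \<rho>p 1" "\<rho>m 2 = - 1 - \<rho>p 2" "\<rho>m 3 = - 1 - \<rho>p 3"
    using \<rho> by simp_all
  show ?thesis
    unfolding m by (simp add: det3_def E_term_def next3 algebra_simps del: One_nat_def)
qed

text \<open>With \<beta> for \<open>beta \<rho>p \<rho>m i\<close>, the weights are (\<beta> - 1) /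
  2 and - (\<beta> + 1) / 2. In the difference of their triple products the terms of even degree in
  the \<beta> cancel.\<close>

lemma beta_sum_prod_eq:
  assumes \<rho>: "\<forall>i\<in>{1, 2, 3}. \<rho>p i + \<rho>m i = -1"
  shows "(\<Sum>i\<in>{1, 2, 3}. beta \<rho>p \<rho>m i) + (\<Prod>i\<in>{1, 2, 3}. beta \<rho>p \<rho>m i)
    = 4 * (\<rho>p 1 * \<rho>p 2 * \<rho>p 3 - \<rho>m 1 * \<rho>m 2 * \<rho>m 3)"
proof -
  have m: "\<rho>m 1 = - 1 - \<rho>p 1" "\<rho>m 2 = - 1 - \<rho>p 2" "\<rho>m 3 = - 1 - \<rho>p 3"
    using \<rho> by simp_all
  show ?thesis
    by (simp add: beta_def m algebra_simps del: One_nat_def)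
qed

section \<open>The complexified system\<close>

definition state :: "nat \<Rightarrow> (nat \<Rightarrow> nat \<Rightarrow> complex) \<Rightarrow> (nat \<Rightarrow> nat \<Rightarrow> complex) \<Rightarrow> complex vec" where
  "state n z w = vec (6 * n) (\<lambda>r.
    if r < 3 * n then z (r div n + 1) (r mod n)
    else w ((r - 3 * n) div n + 1) ((r - 3 * n) mod n))"

definition cinteraction ::
  "nat \<Rightarrow> (nat \<Rightarrow> real) \<Rightarrow> (nat \<Rightarrow> real) \<Rightarrow> (nat \<Rightarrow> nat \<Rightarrow> complex) \<Rightarrow> nat \<Rightarrow> nat \<Rightarrow> complex" where
  "cinteraction n \<rho>p \<rho>m y i j =
    (if i = 1 then y 1 j + \<rho>p 1 * y 2 j + \<rho>m 1 * y 3 ((j + n - 1) mod n)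
     else if i = 2 then y 2 j + \<rho>p 2 * y 3 j + \<rho>m 2 * y 1 j
     else y 3 j + \<rho>p 3 * y 1 ((j + 1) mod n) + \<rho>m 3 * y 2 j)"

lemma state_carrier [simp]: "state n z w \<in> carrier_vec (6 * n)"
  by (simp add: state_def)

lemma state_index_cases:
  fixes r n :: nat
  assumes "r < 3 * n"
  shows "r div n + 1 \<in> {1, 2, 3}" "r mod n < n"
proof -
  have "n > 0" using assms by simp
  moreover have "r div n < 3" using assms by (simp add: less_mult_imp_div_less)
  ultimately show "r div n + 1 \<in> {1, 2, 3}" "r mod n < n" by auto
qed

lemma state_index:
  assumes "i \<in> {1, 2, 3}" and "j < n"
  shows "state n z w $ ((i - 1) * n + j) = z i j"
    and "state n z w $ (3 * n + (i - 1) * n + j) = w i j"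
proof -
  have k: "(i - 1) * n + j < 3 * n" using state_index_less[OF assms] .
  define k where "k = (i - 1) * n + j"
  have "k div n + 1 = i" "k mod n = j"
    using assms by (auto simp: k_def)
  then show "state n z w $ ((i - 1) * n + j) = z i j"
    "state n z w $ (3 * n + (i - 1) * n + j) = w i j"
    using k unfolding add.assoc k_def[symmetric] by (simp_all add: state_def)
qed

lemma state_cong:
  assumes "\<And>i j. i \<in> {1, 2, 3} \<Longrightarrow> j < n \<Longrightarrow> z i j = z' i j"
    and "\<And>i j. i \<in> {1, 2, 3} \<Longrightarrow> j < n \<Longrightarrow> w i j = w' i j"
  shows "state n z w = state n z' w'"
proof (rule eq_vecI)
  fix r assume "r < dim_vec (state n z' w')"
  then have r: "r < 6 * n" by (simp add: state_def)
  show "state n z w $ r = state n z' w' $ r"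
  proof (cases "r < 3 * n")
    case True
    then show ?thesis using r state_index_cases[OF True] assms(1) by (simp add: state_def)
  next
    case False
    then have "r - 3 * n < 3 * n" using r by simp
    then show ?thesis using r False state_index_cases[of "r - 3 * n" n] assms(2)
      by (simp add: state_def)
  qed
qed (simp add: state_def)

lemma smult_state: "c \<cdot>\<^sub>v state n z w = state n (\<lambda>i j. c * z i j) (\<lambda>i j. c * w i j)"
  by (intro eq_vecI) (auto simp: state_def)

lemma state_zero: "state n (\<lambda>i j. 0) (\<lambda>i j. 0) = 0\<^sub>v (6 * n)"
  by (intro eq_vecI) (auto simp: state_def)

lemma interaction_cong:
  assumes "\<And>i j. i \<in> {1, 2, 3} \<Longrightarrow> j < n \<Longrightarrow> y i j = y' i j" and "i \<in> {1, 2, 3}" and "j < n"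
  shows "interaction n \<rho>p \<rho>m y i j = interaction n \<rho>p \<rho>m y' i j"
proof -
  have "(j + n - 1) mod n < n" "(j + 1) mod n < n"
    using assms(3) by (simp_all del: One_nat_def)
  then show ?thesis using assms by (auto simp: interaction_def)
qed

text \<open>The coefficients are real, so real-linear functionals pass through. Taking
  \<open>Re\<close> and \<open>Im\<close> transfers the real matrix action to complex
  states.\<close>

lemma linear_cinteraction:
  fixes f :: "complex \<Rightarrow> real"
  assumes "linear f"
  shows "f (cinteraction n \<rho>p \<rho>m y i j) = interaction n \<rho>p \<rho>m (\<lambda>i j. f (y i j)) i j"
  using assms
  by (simp add: cinteraction_def interaction_def linear_add linear_scale flip: scaleR_conv_of_real)

lemma linear_of_real_mult_mat_vec:
  fixes f :: "complex \<Rightarrow> real"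
  assumes f: "linear f" and A: "A \<in> carrier_mat m k" and u: "u \<in> carrier_vec k" and r: "r < m"
  shows "f ((map_mat complex_of_real A *\<^sub>v u) $ r) = (A *\<^sub>v map_vec f u) $ r"
proof -
  have "f ((map_mat complex_of_real A *\<^sub>v u) $ r) = (\<Sum>c<k. f (complex_of_real (A $$ (r, c)) * u $ c))"
    using A u r by (auto simp: scalar_prod_def lessThan_atLeast0 linear_sum[OF f] intro!: sum.cong)
  also have "\<dots> = (A *\<^sub>v map_vec f u) $ r"
    using A u r
    by (simp add: scalar_prod_def lessThan_atLeast0 linear_scale[OF f] flip: scaleR_conv_of_real)
  finally show ?thesis .
qed

context
  fixes gx gv \<rho>xp \<rho>xm \<rho>vp \<rho>vm :: "nat \<Rightarrow> real"
begin

abbreviation (input) M :: "nat \<Rightarrow> real mat" where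
  "M \<equiv> system_matrix gx gv \<rho>xp \<rho>xm \<rho>vp \<rho>vm"

abbreviation (input) MC :: "nat \<Rightarrow> complex mat" where
  "MC n \<equiv> map_mat complex_of_real (M n)"

lemma MC_carrier [simp]: "MC n \<in> carrier_mat (6 * n) (6 * n)"
  by simp

lemma MC_mult_state:
  "MC n *\<^sub>v state n z w = state n w (\<lambda>i j.
    gx i * cinteraction n \<rho>xp \<rho>xm z i j + gv i * cinteraction n \<rho>vp \<rho>vm w i j)"
    (is "_ = state n w ?acc")
proof (rule eq_vecI)
  fix r assume "r < dim_vec (state n w ?acc)"
  then have r: "r < 6 * n" by (simp add: state_def)
  let ?u = "state n z w"
  have "f ((MC n *\<^sub>v ?u) $ r) = f (state n w ?acc $ r)" if f: "linear f" for f :: "complex \<Rightarrow> real"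
  proof -
    let ?v = "map_vec f ?u"
    have v: "?v \<in> carrier_vec (6 * n)" by simp
    have "f ((MC n *\<^sub>v ?u) $ r) = (M n *\<^sub>v ?v) $ r"
      using r by (intro linear_of_real_mult_mat_vec[OF f system_matrix_carrier state_carrier])
    also have "\<dots> = f (state n w ?acc $ r)"
    proof (cases "r < 3 * n")
      case True
      then show ?thesis
        using r by (simp add: system_matrix_mult[OF v] system_rhs_def) (simp add: state_def)
    next
      case False
      define i where "i = (r - 3 * n) div n + 1"
      define j where "j = (r - 3 * n) mod n"
      have ij: "i \<in> {1, 2, 3}" "j < n"
        using state_index_cases[of "r - 3 * n" n] r False by (simp_all add: i_def j_def)
      have pos: "position n ?v k l = f (z k l)" and vel: "velocity n ?v k l = f (w k l)"
        if kl: "k \<in> {1, 2, 3}" "l < n" for k l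
      proof -
        have "(k - 1) * n + l < 6 * n" "3 * n + (k - 1) * n + l < 6 * n"
          using state_index_less[OF kl] by linarith+
        then show "position n ?v k l = f (z k l)" "velocity n ?v k l = f (w k l)"
          unfolding position_def velocity_def state_index[OF kl, of z w, symmetric]
          by (auto intro!: index_map_vec(1) simp: carrier_vecD[OF state_carrier] simp del: One_nat_def)
      qed
      have "(M n *\<^sub>v ?v) $ r = gx i * interaction n \<rho>xp \<rho>xm (position n ?v) i j
          + gv i * interaction n \<rho>vp \<rho>vm (velocity n ?v) i j"
        using r False by (simp add: system_matrix_mult[OF v] system_rhs_def acceleration_def i_def j_def)
      also have "interaction n \<rho>xp \<rho>xm (position n ?v) i j = f (cinteraction n \<rho>xp \<rho>xm z i j)"
        unfolding linear_cinteraction[OF f] by (intro interaction_cong pos ij)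
      also have "interaction n \<rho>vp \<rho>vm (velocity n ?v) i j = f (cinteraction n \<rho>vp \<rho>vm w i j)"
        unfolding linear_cinteraction[OF f] by (intro interaction_cong vel ij)
      also have "gx i * f (cinteraction n \<rho>xp \<rho>xm z i j) + gv i * f (cinteraction n \<rho>vp \<rho>vm w i j)
          = f (state n w ?acc $ r)"
        using r False f
        by (simp add: state_def i_def j_def linear_add linear_scale flip: scaleR_conv_of_real)
      finally show ?thesis .
    qed
    finally show ?thesis .
  qed
  from this[of Re] this[of Im] show "(MC n *\<^sub>v ?u) $ r = state n w ?acc $ r"
    by (simp add: complex_eq_iff bounded_linear_Re bounded_linear_Im bounded_linear.linear)
qed (simp_all add: state_def system_matrix_def)

text \<open>Velocities equal to \<open>\<mu>\<close> times the positions reduce the first-order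
  eigenproblem to a quadratic one for the positions.\<close>

lemma eigenvector_stateI:
  fixes \<mu> :: complex
  assumes "\<And>i j. i \<in> {1, 2, 3} \<Longrightarrow> j < n \<Longrightarrow>
    \<mu>\<^sup>2 * z i j = gx i * cinteraction n \<rho>xp \<rho>xm z i j
      + \<mu> * gv i * cinteraction n \<rho>vp \<rho>vm z i j"
  shows "MC n *\<^sub>v state n z (\<lambda>i j. \<mu> * z i j) = \<mu> \<cdot>\<^sub>v state n z (\<lambda>i j. \<mu> * z i j)"
proof -
  have "cinteraction n \<rho>vp \<rho>vm (\<lambda>i j. \<mu> * z i j) i j = \<mu> * cinteraction n \<rho>vp \<rho>vm z i j" for i j
    by (simp add: cinteraction_def algebra_simps)
  then show ?thesis
    unfolding MC_mult_state smult_state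
    using assms by (intro state_cong) (simp_all add: power2_eq_square mult_ac)
qed

section \<open>Fourier modes and the dispersion polynomial\<close>

text \<open>An entry of the 3x3 quadratic eigenvalue problem: \<open>\<delta>\<close> is 1 on the
  diagonal and 0 elsewhere, \<open>t\<close> is the phase of the neighbour.\<close>

definition mode_entry :: "real \<Rightarrow> real \<Rightarrow> complex \<Rightarrow> complex \<Rightarrow> complex poly" where
  "mode_entry a b \<delta> t = [:- (of_real a * t), - (of_real b * t), \<delta>:]"

lemma poly_mode_entry: "poly (mode_entry a b \<delta> t) x = \<delta> * x\<^sup>2 - (of_real a + of_real b * x) * t"
  by (simp add: mode_entry_def algebra_simps power2_eq_square)

text \<open>Rows are the equations and columns the amplitudes of types 1, 2, 3. Type 1 sees type 3
  at \<open>j - 1\<close> with phase \<open>1 / \<omega>\<close>; type 3 sees type 1 at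
  \<open>j + 1\<close> with phase \<open>\<omega>\<close>.\<close>

definition dispersion :: "complex \<Rightarrow> complex poly" where
  "dispersion \<omega> = det3
    (mode_entry (gx 1) (gv 1) 1 1) (mode_entry (gx 1 * \<rho>xp 1) (gv 1 * \<rho>vp 1) 0 1)
      (mode_entry (gx 1 * \<rho>xm 1) (gv 1 * \<rho>vm 1) 0 (1 / \<omega>))
    (mode_entry (gx 2 * \<rho>xm 2) (gv 2 * \<rho>vm 2) 0 1) (mode_entry (gx 2) (gv 2) 1 1)
      (mode_entry (gx 2 * \<rho>xp 2) (gv 2 * \<rho>vp 2) 0 1)
    (mode_entry (gx 3 * \<rho>xp 3) (gv 3 * \<rho>vp 3) 0 \<omega>) (mode_entry (gx 3 * \<rho>xm 3) (gv 3 * \<rho>vm 3) 0 1)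
      (mode_entry (gx 3) (gv 3) 1 1)"

lemma dispersion_root_eigenvector:
  fixes \<omega> \<mu> :: complex
  assumes n: "n > 0" and \<omega>: "\<omega> ^ n = 1" and root: "poly (dispersion \<omega>) \<mu> = 0"
  obtains a :: "nat \<Rightarrow> complex" where "\<exists>i\<in>{1, 2, 3}. a i \<noteq> 0"
    "MC n *\<^sub>v state n (\<lambda>i j. a i * \<omega> ^ j) (\<lambda>i j. \<mu> * (a i * \<omega> ^ j))
      = \<mu> \<cdot>\<^sub>v state n (\<lambda>i j. a i * \<omega> ^ j) (\<lambda>i j. \<mu> * (a i * \<omega> ^ j))"
proof -
  have \<omega>0: "\<omega> \<noteq> 0" using \<omega> n by (auto simp: zero_power)
  obtain x y z :: complex where xyz: "x \<noteq> 0 \<or> y \<noteq> 0 \<or> z \<noteq> 0"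
    and eqs: "poly (mode_entry (gx 1) (gv 1) 1 1) \<mu> * x
        + poly (mode_entry (gx 1 * \<rho>xp 1) (gv 1 * \<rho>vp 1) 0 1) \<mu> * y
        + poly (mode_entry (gx 1 * \<rho>xm 1) (gv 1 * \<rho>vm 1) 0 (1 / \<omega>)) \<mu> * z = 0"
      "poly (mode_entry (gx 2 * \<rho>xm 2) (gv 2 * \<rho>vm 2) 0 1) \<mu> * x
        + poly (mode_entry (gx 2) (gv 2) 1 1) \<mu> * y
        + poly (mode_entry (gx 2 * \<rho>xp 2) (gv 2 * \<rho>vp 2) 0 1) \<mu> * z = 0"
      "poly (mode_entry (gx 3 * \<rho>xp 3) (gv 3 * \<rho>vp 3) 0 \<omega>) \<mu> * x
        + poly (mode_entry (gx 3 * \<rho>xm 3) (gv 3 * \<rho>vm 3) 0 1) \<mu> * y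
        + poly (mode_entry (gx 3) (gv 3) 1 1) \<mu> * z = 0"
    using root unfolding dispersion_def poly_det3 by (rule det3_zero_kernel)
  define a where "a i = (if i = 1 then x else if i = 2 then y else z)" for i :: nat
  have wrap: "\<omega> ^ (k mod n) = \<omega> ^ k" for k
  proof -
    have "\<omega> ^ k = \<omega> ^ (n * (k div n) + k mod n)" by simp
    also have "\<dots> = \<omega> ^ (k mod n)" using \<omega> by (simp only: power_add power_mult) simp
    finally show ?thesis ..
  qed
  \<comment> \<open>The predecessor is encoded as \<open>j + n - 1\<close>; the full turn
    \<open>\<omega> ^ n = 1\<close> reduces its phase to \<open>1 / \<omega>\<close>.\<close>
  have "\<omega> * \<omega> ^ (j + n - 1) = \<omega> ^ j" for j
    using n \<omega> by (metis Nat.add_diff_assoc One_nat_def Suc_leI add_Suc_right mult.right_neutral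
        plus_1_eq_Suc power_Suc power_add le_add_diff_inverse)
  then have prev: "\<omega> ^ (j + n - 1) = \<omega> ^ j / \<omega>" for j
    using \<omega>0 by (metis nonzero_mult_div_cancel_left)
  have rows:
    "\<mu>\<^sup>2 * x = gx 1 * (x + \<rho>xp 1 * y + \<rho>xm 1 * (z / \<omega>)) + \<mu> * gv 1 * (x + \<rho>vp 1 * y + \<rho>vm 1 * (z / \<omega>))"
    "\<mu>\<^sup>2 * y = gx 2 * (y + \<rho>xp 2 * z + \<rho>xm 2 * x) + \<mu> * gv 2 * (y + \<rho>vp 2 * z + \<rho>vm 2 * x)"
    "\<mu>\<^sup>2 * z = gx 3 * (z + \<rho>xp 3 * (x * \<omega>) + \<rho>xm 3 * y) + \<mu> * gv 3 * (z + \<rho>vp 3 * (x * \<omega>) + \<rho>vm 3 * y)"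
    using eqs by (simp_all add: poly_mode_entry algebra_simps)
  have "\<mu>\<^sup>2 * (a i * \<omega> ^ j) = gx i * cinteraction n \<rho>xp \<rho>xm (\<lambda>i j. a i * \<omega> ^ j) i j
      + \<mu> * gv i * cinteraction n \<rho>vp \<rho>vm (\<lambda>i j. a i * \<omega> ^ j) i j"
    if i: "i \<in> {1, 2, 3}" for i j
  proof -
    have "\<mu>\<^sup>2 * a i * \<omega> ^ j = (gx i * cinteraction n \<rho>xp \<rho>xm (\<lambda>i j. a i * \<omega> ^ j) i j
      + \<mu> * gv i * cinteraction n \<rho>vp \<rho>vm (\<lambda>i j. a i * \<omega> ^ j) i j)"
      using i
      by (elim insertE; simp add: cinteraction_def a_def wrap prev rows del: One_nat_def)
        (simp_all add: algebra_simps)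
    then show ?thesis by (simp only: mult.assoc)
  qed
  then have "MC n *\<^sub>v state n (\<lambda>i j. a i * \<omega> ^ j) (\<lambda>i j. \<mu> * (a i * \<omega> ^ j))
      = \<mu> \<cdot>\<^sub>v state n (\<lambda>i j. a i * \<omega> ^ j) (\<lambda>i j. \<mu> * (a i * \<omega> ^ j))"
    by (intro eigenvector_stateI)
  moreover have "\<exists>i\<in>{1, 2, 3}. a i \<noteq> 0"
    using xyz by (auto simp: a_def)
  ultimately show thesis using that by blast
qed

text \<open>The coefficient of the quadratic term in the limit of the rescaled dispersion
  polynomial.\<close>

definition curvature :: real where
  "curvature = (\<Sum>i\<in>{1, 2, 3}. E_term (gx i) (gx (next3 i)) (\<rho>xp i) (\<rho>xp (next3 i)))"

text \<open>The constant term of that limit is \<open>- \<i> * drift\<close>. By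
  \<open>beta_sum_prod_eq\<close>, this is a quarter of the expression in the third
  condition.\<close>

definition drift :: real where
  "drift = gx 1 * gx 2 * gx 3 * (\<rho>xp 1 * \<rho>xp 2 * \<rho>xp 3 - \<rho>xm 1 * \<rho>xm 2 * \<rho>xm 3)"

context
  assumes \<rho>x: "\<forall>i\<in>{1, 2, 3}. \<rho>xp i + \<rho>xm i = -1"
    and \<rho>v: "\<forall>i\<in>{1, 2, 3}. \<rho>vp i + \<rho>vm i = -1"
begin

lemma row_sums:
  "1 + complex_of_real (\<rho>xp i) + of_real (\<rho>xm i) = 0"
  "1 + complex_of_real (\<rho>vp i) + of_real (\<rho>vm i) = 0" if "i \<in> {1, 2, 3}"
proof -
  have "1 + \<rho>xp i + \<rho>xm i = 0" "1 + \<rho>vp i + \<rho>vm i = 0"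
    using \<rho>x[rule_format, OF that] \<rho>v[rule_format, OF that] by linarith+
  then show "1 + complex_of_real (\<rho>xp i) + of_real (\<rho>xm i) = 0"
    "1 + complex_of_real (\<rho>vp i) + of_real (\<rho>vm i) = 0"
    by (metis of_real_0 of_real_1 of_real_add)+
qed

lemma cinteraction_const:
  assumes "i \<in> {1, 2, 3}"
  shows "cinteraction n \<rho>xp \<rho>xm (\<lambda>i j. e) i j = 0" "cinteraction n \<rho>vp \<rho>vm (\<lambda>i j. e) i j = 0"
proof -
  have "cinteraction n \<rho>p \<rho>m (\<lambda>i j. e) i j = (1 + of_real (\<rho>p i) + of_real (\<rho>m i)) * e"
    for \<rho>p \<rho>m
    using assms by (auto simp: cinteraction_def algebra_simps)
  then show "cinteraction n \<rho>xp \<rho>xm (\<lambda>i j. e) i j = 0" "cinteraction n \<rho>vp \<rho>vm (\<lambda>i j. e) i j = 0"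
    using row_sums[OF assms] by simp_all
qed

lemma cinteraction_zero: "cinteraction n \<rho>p \<rho>m (\<lambda>i j. 0) i j = 0"
  by (simp add: cinteraction_def)

section \<open>Instability caused by the eigenvalue zero\<close>

text \<open>Constant positions at rest are in the kernel because the interaction weights add up to
  zero; geometric multiplicity one leaves only their multiples.\<close>

lemma linearly_stable_kernel_const:
  assumes stable: "linearly_stable (M n)" and n: "n > 0"
    and ker: "MC n *\<^sub>v state n z (\<lambda>i j. 0) = 0\<^sub>v (6 * n)"
  shows "\<exists>e. \<forall>i\<in>{1, 2, 3}. \<forall>j<n. z i j = e"
proof -
  let ?one = "state n (\<lambda>i j. 1) (\<lambda>i j. 0)"
  have "geometric_mult (MC n) 0 = 1"
    using stable by (simp add: linearly_stable_def Let_def)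
  then obtain b where b: "\<And>v. v \<in> carrier_vec (6 * n) \<Longrightarrow> MC n *\<^sub>v v = 0 \<cdot>\<^sub>v v \<Longrightarrow> \<exists>c. v = c \<cdot>\<^sub>v b"
    using geometric_mult_1_eigenspace[OF MC_carrier] by blast
  have zero: "0 \<cdot>\<^sub>v state n z w = 0\<^sub>v (6 * n)" for z w
    by (simp add: smult_state state_zero)
  have "MC n *\<^sub>v ?one = 0\<^sub>v (6 * n)"
    unfolding MC_mult_state state_zero[symmetric]
    by (intro state_cong) (simp_all only: cinteraction_const cinteraction_zero mult_zero_right add_0)
  then obtain c where c: "?one = c \<cdot>\<^sub>v b" using b[of ?one] by (auto simp: zero)
  obtain c' where c': "state n z (\<lambda>i j. 0) = c' \<cdot>\<^sub>v b" using b[of "state n z (\<lambda>i j. 0)"] ker by (auto simp: zero)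
  have b_dim: "dim_vec b = 6 * n"
    using arg_cong[OF c, of dim_vec] by (simp add: state_def)
  have idx: "1 = c * b $ ((i - 1) * n + j)" "z i j = c' * b $ ((i - 1) * n + j)"
    if ij: "i \<in> {1, 2, 3}" "j < n" for i j
  proof -
    have "(i - 1) * n + j < dim_vec b" using state_index_less[OF ij] b_dim by linarith
    then show "1 = c * b $ ((i - 1) * n + j)" "z i j = c' * b $ ((i - 1) * n + j)"
      using state_index(1)[OF ij, of "\<lambda>i j. 1" "\<lambda>i j. 0"] state_index(1)[OF ij, of z "\<lambda>i j. 0"]
      unfolding c c' by simp_all
  qed
  have "z i j = c' / c" if "i \<in> {1, 2, 3}" "j < n" for i j
    using idx[OF that] by (cases "c = 0") (simp_all add: field_simps)
  then show ?thesis by blast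
qed

lemma not_stable_if_gx_zero:
  assumes g: "gx 1 = 0 \<or> gx 2 = 0 \<or> gx 3 = 0" and n: "n \<ge> 2"
  shows "\<not> linearly_stable (M n)"
proof
  assume stable: "linearly_stable (M n)"
  define \<omega> where "\<omega> = cis (2 * pi / n)"
  have "\<omega> ^ n = cis (2 * pi)"
    using n by (simp add: \<omega>_def DeMoivre)
  then have \<omega>n: "\<omega> ^ n = 1" by simp
  \<comment> \<open>For \<open>n \<ge> 2\<close> the angle lies in the interval from 0 to
    \<open>pi\<close>, where the cosine strictly decreases.\<close>
  have "cos (2 * pi / n) < cos 0"
    using n by (intro cos_monotone_0_pi) (auto simp: field_simps)
  then have \<omega>1: "\<omega> \<noteq> 1" by (auto simp: \<omega>_def complex_eq_iff)
  have "poly (dispersion \<omega>) 0 = 0"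
    using g by (auto simp: dispersion_def poly_det3 poly_mode_entry det3_def)
  then obtain a where a: "\<exists>i\<in>{1, 2, 3}. a i \<noteq> 0"
    "MC n *\<^sub>v state n (\<lambda>i j. a i * \<omega> ^ j) (\<lambda>i j. 0 * (a i * \<omega> ^ j))
      = 0 \<cdot>\<^sub>v state n (\<lambda>i j. a i * \<omega> ^ j) (\<lambda>i j. 0 * (a i * \<omega> ^ j))"
    using dispersion_root_eigenvector[OF _ \<omega>n, of 0] n by auto
  then have "MC n *\<^sub>v state n (\<lambda>i j. a i * \<omega> ^ j) (\<lambda>i j. 0) = 0\<^sub>v (6 * n)"
    by (simp add: smult_state state_zero)
  then obtain e where e: "\<forall>i\<in>{1, 2, 3}. \<forall>j<n. a i * \<omega> ^ j = e"
    using linearly_stable_kernel_const[OF stable, of "\<lambda>i j. a i * \<omega> ^ j"] n by auto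
  from a(1) obtain i where i: "i \<in> {1, 2, 3}" "a i \<noteq> 0" by blast
  have "a i * \<omega> ^ 0 = e" "a i * \<omega> ^ 1 = e"
    using e[rule_format, OF i(1), of 0] e[rule_format, OF i(1), of 1] n by simp_all
  then show False using i \<omega>1 by auto
qed

text \<open>A kernel vector \<open>(x, y, q)\<close> says that the displacement
  \<open>(x, y, 0)\<close> accelerates every vehicle by \<open>- q\<close>. For \<open>q = 0\<close>
  this is a nonconstant kernel state; otherwise a multiple of it prolongs the Jordan chain.\<close>

lemma not_stable_if_E_sum_zero:
  assumes E: "(\<Sum>i\<in>{1, 2, 3}. E_term (gx i) (gx (next3 i)) (\<rho>xp i) (\<rho>xp (next3 i))) = 0"
    and n: "n > 0"
  shows "\<not> linearly_stable (M n)"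
proof
  assume stable: "linearly_stable (M n)"
  \<comment> \<open>The rows of position coefficients sum to zero, so putting ones in the third
    column gives the same determinant as putting them in the first.\<close>
  have "det3 (gx 1) (gx 1 * \<rho>xp 1) 1 (gx 2 * \<rho>xm 2) (gx 2) 1 (gx 3 * \<rho>xp 3) (gx 3 * \<rho>xm 3) 1 = 0"
  proof -
    have m: "\<rho>xm 1 = - 1 - \<rho>xp 1" "\<rho>xp 2 = - 1 - \<rho>xm 2" "\<rho>xp 3 = - 1 - \<rho>xm 3"
      using \<rho>x by simp_all
    show ?thesis
      using E unfolding E_term_sum_eq[OF \<rho>x] det3_def m by (simp add: algebra_simps del: One_nat_def)
  qed
  then have "complex_of_real (det3 (gx 1) (gx 1 * \<rho>xp 1) 1 (gx 2 * \<rho>xm 2) (gx 2) 1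
      (gx 3 * \<rho>xp 3) (gx 3 * \<rho>xm 3) 1) = 0"
    by simp
  then have "det3 (complex_of_real (gx 1)) (of_real (gx 1 * \<rho>xp 1)) 1
      (of_real (gx 2 * \<rho>xm 2)) (of_real (gx 2)) 1
      (of_real (gx 3 * \<rho>xp 3)) (of_real (gx 3 * \<rho>xm 3)) 1 = 0"
    by (simp add: det3_def)
  then obtain x y q :: complex where xyq: "x \<noteq> 0 \<or> y \<noteq> 0 \<or> q \<noteq> 0"
    and eqs: "of_real (gx 1) * x + of_real (gx 1 * \<rho>xp 1) * y + 1 * q = 0"
      "of_real (gx 2 * \<rho>xm 2) * x + of_real (gx 2) * y + 1 * q = 0"
      "of_real (gx 3 * \<rho>xp 3) * x + of_real (gx 3 * \<rho>xm 3) * y + 1 * q = 0"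
    by (rule det3_zero_kernel)
  \<comment> \<open>Constants exert no force, so the third amplitude can be normalised to 0.\<close>
  define a where "a i = (if i = 1 then x else if i = 2 then y else 0)" for i :: nat
  have a: "gx i * cinteraction n \<rho>xp \<rho>xm (\<lambda>i j. t * a i) i j = - t * q"
    if "i \<in> {1, 2, 3}" for i j t
  proof -
    have "gx i * cinteraction n \<rho>xp \<rho>xm (\<lambda>i j. a i) i j + q = 0"
      using that eqs by (auto simp: cinteraction_def a_def algebra_simps)
    then have "- q = gx i * cinteraction n \<rho>xp \<rho>xm (\<lambda>i j. a i) i j"
      by (simp add: eq_neg_iff_add_eq_0 neg_eq_iff_add_eq_0 add.commute)
    moreover have "cinteraction n \<rho>xp \<rho>xm (\<lambda>i j. t * a i) i j = t * cinteraction n \<rho>xp \<rho>xm (\<lambda>i j. a i) i j"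
      by (simp add: cinteraction_def algebra_simps)
    ultimately show ?thesis by (metis minus_mult_commute mult.left_commute)
  qed
  have a_img: "MC n *\<^sub>v state n (\<lambda>i j. t * a i) (\<lambda>i j. 0) = state n (\<lambda>i j. 0) (\<lambda>i j. - t * q)" for t
    unfolding MC_mult_state by (intro state_cong) (simp_all only: a cinteraction_zero mult_zero_right add_0_right)
  show False
  proof (cases "q = 0")
    case True
    then have "MC n *\<^sub>v state n (\<lambda>i j. 1 * a i) (\<lambda>i j. 0) = 0\<^sub>v (6 * n)"
      unfolding a_img by (simp add: state_zero)
    then obtain e where "\<forall>i\<in>{1, 2, 3}. \<forall>j<n. 1 * a i = e"
      using linearly_stable_kernel_const[OF stable n, of "\<lambda>i j. 1 * a i"] by blast
    then have "a 1 = a 3" "a 2 = a 3" using n by auto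
    then show False using xyq True by (simp add: a_def)
  next
    case False
    \<comment> \<open>The factor \<open>- 1 / q\<close> makes the acceleration equal to 1, so the
      third vector is mapped to the constant velocities. This gives order at least 3 where stability
      demands 2.\<close>
    define v where "v m = (if m = 0 then state n (\<lambda>i j. 1) (\<lambda>i j. 0)
      else if m = 1 then state n (\<lambda>i j. 0) (\<lambda>i j. 1) else state n (\<lambda>i j. - 1 / q * a i) (\<lambda>i j. 0))"
      for m :: nat
    have v0: "MC n *\<^sub>v v 0 = 0\<^sub>v (6 * n)"
      unfolding v_def state_zero[symmetric] if_P[OF refl] MC_mult_state
      by (intro state_cong) (simp_all only: cinteraction_const cinteraction_zero mult_zero_right add_0)
    have v1: "MC n *\<^sub>v state n (\<lambda>i j. 0) (\<lambda>i j. 1) = state n (\<lambda>i j. 1) (\<lambda>i j. 0)"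
      unfolding MC_mult_state
      by (intro state_cong) (simp_all only: cinteraction_const cinteraction_zero mult_zero_right add_0)
    have v2: "MC n *\<^sub>v state n (\<lambda>i j. - 1 / q * a i) (\<lambda>i j. 0) = state n (\<lambda>i j. 0) (\<lambda>i j. 1)"
      unfolding a_img using False by simp
    have "v 0 $ 0 \<noteq> (0\<^sub>v (6 * n) :: complex vec) $ 0"
      using n by (simp add: v_def state_def)
    then have "v 0 \<noteq> 0\<^sub>v (6 * n)" by auto
    moreover have "MC n *\<^sub>v v (Suc m) = v m" if "m < 2" for m
    proof -
      have "m = 0 \<or> m = 1" using that by linarith
      then show ?thesis using v1 v2 by (auto simp: v_def)
    qed
    ultimately have "Suc 2 \<le> algebraic_mult (MC n) 0"
      unfolding algebraic_mult_def using v0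
      by (intro jordan_chain_order_char_poly[OF MC_carrier, of v]) (simp_all add: v_def)
    then show False using stable by (simp add: linearly_stable_def Let_def)
  qed
qed

section \<open>Instability of long waves\<close>

text \<open>At phase 1 the rows of the mode matrix sum to the square of the eigenvalue. The scaling
  by \<open>sqrt (\<phi> n)\<close> makes this square as small as the phase error, so one factor
  \<open>\<phi> n\<close> comes out of the column sum and the remaining determinant
  converges.\<close>

lemma tendsto_dispersion:
  fixes \<phi> :: "nat \<Rightarrow> real"
  assumes \<phi>: "\<phi> \<longlonglongrightarrow> 0" "\<And>n. \<phi> n > 0"
  shows "(\<lambda>n. poly (dispersion (cis (\<phi> n))) (of_real (sqrt (\<phi> n)) * \<mu>)
    / of_real (\<phi> n)) \<longlonglongrightarrow> of_real curvature * \<mu>\<^sup>2 - \<i> * of_real drift"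
proof -
  define \<epsilon> where "\<epsilon> n = complex_of_real (sqrt (\<phi> n))" for n
  define \<omega> where "\<omega> n = cis (\<phi> n)" for n
  define P where "P n = (\<omega> n - 1) / of_real (\<phi> n)" for n
  define Q where "Q n = (1 / \<omega> n - 1) / of_real (\<phi> n)" for n
  \<comment> \<open>The first column holds the row sums divided by \<open>\<phi> n\<close>;
    \<open>P\<close> and \<open>Q\<close> are the difference quotients of the phases.\<close>
  define F where "F n = det3
    (\<mu>\<^sup>2 - (of_real (gx 1 * \<rho>xm 1) + of_real (gv 1 * \<rho>vm 1) * (\<epsilon> n * \<mu>)) * Q n)
      (poly (mode_entry (gx 1 * \<rho>xp 1) (gv 1 * \<rho>vp 1) 0 1) (\<epsilon> n * \<mu>))
      (poly (mode_entry (gx 1 * \<rho>xm 1) (gv 1 * \<rho>vm 1) 0 (1 / \<omega> n)) (\<epsilon> n * \<mu>))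
    (\<mu>\<^sup>2)
      (poly (mode_entry (gx 2) (gv 2) 1 1) (\<epsilon> n * \<mu>))
      (poly (mode_entry (gx 2 * \<rho>xp 2) (gv 2 * \<rho>vp 2) 0 1) (\<epsilon> n * \<mu>))
    (\<mu>\<^sup>2 - (of_real (gx 3 * \<rho>xp 3) + of_real (gv 3 * \<rho>vp 3) * (\<epsilon> n * \<mu>)) * P n)
      (poly (mode_entry (gx 3 * \<rho>xm 3) (gv 3 * \<rho>vm 3) 0 1) (\<epsilon> n * \<mu>))
      (poly (mode_entry (gx 3) (gv 3) 1 1) (\<epsilon> n * \<mu>))" for n
  have mx: "\<rho>xp 1 = - 1 - \<rho>xm 1" "\<rho>xp 2 = - 1 - \<rho>xm 2" "\<rho>xm 3 = - 1 - \<rho>xp 3"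
    and mv: "\<rho>vp 1 = - 1 - \<rho>vm 1" "\<rho>vp 2 = - 1 - \<rho>vm 2" "\<rho>vm 3 = - 1 - \<rho>vp 3"
    using \<rho>x \<rho>v by simp_all
  have "poly (dispersion (\<omega> n)) (\<epsilon> n * \<mu>) = of_real (\<phi> n) * F n" for n
  proof -
    have \<epsilon>: "\<epsilon> n * \<epsilon> n = of_real (\<phi> n)"
      using \<phi>(2)[of n] by (simp add: \<epsilon>_def flip: of_real_mult)
    have P: "of_real (\<phi> n) * P n = \<omega> n - 1" and Q: "of_real (\<phi> n) * Q n = 1 / \<omega> n - 1"
      using \<phi>(2)[of n] by (simp_all add: P_def Q_def)
    define x where "x = \<epsilon> n * \<mu>"
    have x2: "x\<^sup>2 = of_real (\<phi> n) * \<mu>\<^sup>2"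
      using \<epsilon> by (simp add: x_def power2_eq_square algebra_simps flip: mult.assoc)
    have first: "of_real (\<phi> n) * (\<mu>\<^sup>2 - K * Q n) = x\<^sup>2 - K * (1 / \<omega> n - 1)"
      and third: "of_real (\<phi> n) * (\<mu>\<^sup>2 - K * P n) = x\<^sup>2 - K * (\<omega> n - 1)" for K
      unfolding x2 P[symmetric] Q[symmetric] by (simp_all add: algebra_simps)
    show ?thesis
      unfolding dispersion_def F_def poly_det3 x_def[symmetric]
    proof (rule det3_scaled_column_sum, goal_cases)
      case 1
      show ?case
        unfolding first poly_mode_entry mx mv by (simp add: algebra_simps del: One_nat_def)
    next
      case 2
      show ?case
        unfolding x2[symmetric] poly_mode_entry mx mv by (simp add: algebra_simps del: One_nat_def)
    next
      case 3
      show ?case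
        unfolding third poly_mode_entry mx mv by (simp add: algebra_simps del: One_nat_def)
    qed
  qed
  then have eq: "poly (dispersion (cis (\<phi> n))) (of_real (sqrt (\<phi> n)) * \<mu>)
      / of_real (\<phi> n) = F n" for n
    using \<phi>(2)[of n] by (simp add: \<epsilon>_def \<omega>_def)
  have \<epsilon>: "\<epsilon> \<longlonglongrightarrow> 0"
    unfolding \<epsilon>_def using tendsto_of_real[OF tendsto_real_sqrt[OF \<phi>(1)]] by simp
  have P: "P \<longlonglongrightarrow> \<i>"
    unfolding P_def \<omega>_def using \<phi> by (intro tendsto_cis_quotient) (auto simp: less_imp_neq[symmetric])
  have \<omega>: "\<omega> \<longlonglongrightarrow> 1"
    unfolding \<omega>_def using \<phi>(1) by (auto simp: cis_conv_exp intro!: tendsto_eq_intros)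
  have "Q = (\<lambda>n. - P n / \<omega> n)"
    by (simp add: fun_eq_iff P_def Q_def \<omega>_def divide_simps)
  then have Q: "Q \<longlonglongrightarrow> - \<i>"
    using tendsto_divide[OF tendsto_minus[OF P] \<omega>] by simp
  have "F \<longlonglongrightarrow> det3
    (\<mu>\<^sup>2 + of_real (gx 1 * \<rho>xm 1) * \<i>) (- of_real (gx 1 * \<rho>xp 1)) (- of_real (gx 1 * \<rho>xm 1))
    (\<mu>\<^sup>2) (- of_real (gx 2)) (- of_real (gx 2 * \<rho>xp 2))
    (\<mu>\<^sup>2 - of_real (gx 3 * \<rho>xp 3) * \<i>) (- of_real (gx 3 * \<rho>xm 3)) (- of_real (gx 3))"
    unfolding F_def det3_def poly_mode_entry
    by (rule tendsto_eq_intros \<epsilon> \<omega> P Q refl | simp)+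
  also have "det3
    (\<mu>\<^sup>2 + of_real (gx 1 * \<rho>xm 1) * \<i>) (- of_real (gx 1 * \<rho>xp 1)) (- of_real (gx 1 * \<rho>xm 1))
    (\<mu>\<^sup>2) (- of_real (gx 2)) (- of_real (gx 2 * \<rho>xp 2))
    (\<mu>\<^sup>2 - of_real (gx 3 * \<rho>xp 3) * \<i>) (- of_real (gx 3 * \<rho>xm 3)) (- of_real (gx 3))
    = of_real curvature * \<mu>\<^sup>2 - \<i> * of_real drift"
    unfolding curvature_def E_term_sum_eq[OF \<rho>x] drift_def det3_def mx by (simp add: algebra_simps del: One_nat_def)
  finally show ?thesis unfolding eq .
qed

lemma linearly_stable_dispersion_root:
  assumes stable: "linearly_stable (M n)" and n: "n > 0" and \<omega>: "\<omega> ^ n = 1"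
    and root: "poly (dispersion \<omega>) \<mu> = 0"
  shows "Re \<mu> \<le> 0"
proof -
  obtain a where a: "\<exists>i\<in>{1, 2, 3}. a i \<noteq> 0"
    "MC n *\<^sub>v state n (\<lambda>i j. a i * \<omega> ^ j) (\<lambda>i j. \<mu> * (a i * \<omega> ^ j))
      = \<mu> \<cdot>\<^sub>v state n (\<lambda>i j. a i * \<omega> ^ j) (\<lambda>i j. \<mu> * (a i * \<omega> ^ j))"
    using dispersion_root_eigenvector[OF n \<omega> root] by blast
  let ?u = "state n (\<lambda>i j. a i * \<omega> ^ j) (\<lambda>i j. \<mu> * (a i * \<omega> ^ j))"
  from a(1) obtain i where i: "i \<in> {1, 2, 3}" "a i \<noteq> 0" by blast
  have "?u $ ((i - 1) * n + 0) = a i"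
    using state_index(1)[OF i(1) n, of "\<lambda>i j. a i * \<omega> ^ j"] by simp
  moreover have "(i - 1) * n + 0 < 6 * n" using state_index_less[OF i(1) n] by linarith
  ultimately have "?u \<noteq> 0\<^sub>v (6 * n)" using i(2) by (metis index_zero_vec(1))
  then have "eigenvector (MC n) ?u \<mu>"
    using a(2) carrier_matD[OF MC_carrier[of n]] by (simp add: eigenvector_def)
  then have "eigenvalue (MC n) \<mu>" by (auto simp: eigenvalue_def)
  then show ?thesis
    using stable by (cases "\<mu> = 0") (force simp: linearly_stable_def Let_def)+
qed

text \<open>In the limit the reflection inequality would compare
  \<open>2 * \<bar>drift\<bar>\<close> at \<open>- cnj \<mu>\<close> with 0 at the root
  \<open>\<mu>\<close>, so it fails for large \<open>n\<close>.\<close>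

lemma eventually_not_stable:
  assumes c: "curvature \<noteq> 0" and d: "drift \<noteq> 0"
  shows "\<forall>\<^sub>F n in sequentially. \<not> linearly_stable (M n)"
proof -
  \<comment> \<open>\<open>Suc n\<close> keeps the angle positive and finite for every
    \<open>n\<close>; the shift is undone at the end.\<close>
  define \<phi> where "\<phi> n = 2 * pi / real (Suc n)" for n
  have \<phi>0: "\<phi> \<longlonglongrightarrow> 0"
    unfolding \<phi>_def using tendsto_mult_right_zero[OF LIMSEQ_inverse_real_of_nat, of "2 * pi"]
    by (simp add: divide_inverse)
  have \<phi>: "\<phi> n > 0" for n by (simp add: \<phi>_def)
  define F where "F \<mu> n = poly (dispersion (cis (\<phi> n))) (of_real (sqrt (\<phi> n)) * \<mu>) / of_real (\<phi> n)" for \<mu> n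
  \<comment> \<open>The principal square root selects the root of the limit polynomial with
    nonnegative real part.\<close>
  define \<mu> where "\<mu> = csqrt (\<i> * of_real drift / of_real curvature)"
  have "cnj \<mu> ^ 2 = cnj (\<mu>\<^sup>2)" by simp
  also have "\<dots> = - (\<i> * of_real drift / of_real curvature)" by (simp add: \<mu>_def)
  finally have cnj_\<mu>: "(- cnj \<mu>)\<^sup>2 = - (\<i> * of_real drift / of_real curvature)" by simp
  have "(\<lambda>n. cmod (F (- cnj \<mu>) n) - cmod (F \<mu> n)) \<longlonglongrightarrow>
      cmod (of_real curvature * (- cnj \<mu>)\<^sup>2 - \<i> * of_real drift) - cmod (of_real curvature * \<mu>\<^sup>2 - \<i> * of_real drift)"
    unfolding F_def by (intro tendsto_diff tendsto_norm tendsto_dispersion \<phi>0 \<phi>)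
  moreover have "cmod (of_real curvature * (- cnj \<mu>)\<^sup>2 - \<i> * of_real drift) = 2 * \<bar>drift\<bar>"
  proof -
    have "of_real curvature * (- cnj \<mu>)\<^sup>2 - \<i> * of_real drift = - 2 * \<i> * of_real drift"
      unfolding cnj_\<mu> using c by (simp add: field_simps)
    then have "cmod (of_real curvature * (- cnj \<mu>)\<^sup>2 - \<i> * of_real drift) = cmod (- 2 * \<i> * of_real drift)"
      by (rule arg_cong)
    then show ?thesis by (simp only: norm_mult) simp
  qed
  moreover have "of_real curvature * \<mu>\<^sup>2 - \<i> * of_real drift = 0"
    using c by (simp add: \<mu>_def)
  ultimately have "(\<lambda>n. cmod (F (- cnj \<mu>) n) - cmod (F \<mu> n)) \<longlonglongrightarrow> 2 * \<bar>drift\<bar>"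
    by simp
  then have "\<forall>\<^sub>F n in sequentially. 0 < cmod (F (- cnj \<mu>) n) - cmod (F \<mu> n)"
    using d by (intro order_tendstoD(1)) auto
  then have "\<forall>\<^sub>F n in sequentially. \<not> linearly_stable (M (Suc n))"
  proof eventually_elim
    case (elim n)
    show ?case
    proof
      assume stable: "linearly_stable (M (Suc n))"
      let ?p = "dispersion (cis (\<phi> n))" and ?x = "of_real (sqrt (\<phi> n)) * \<mu>"
      have "cis (\<phi> n) ^ Suc n = cis (2 * pi)"
        unfolding DeMoivre \<phi>_def by (simp del: of_nat_Suc)
      then have "cis (\<phi> n) ^ Suc n = 1" by simp
      then have "Re a \<le> 0" if "poly ?p a = 0" for a
        using linearly_stable_dispersion_root[OF stable _ _ that] by simp
      moreover have "Re ?x \<ge> 0"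
        using csqrt_principal[of "\<i> * of_real drift / of_real curvature"] less_imp_le[OF \<phi>[of n]]
        unfolding \<mu>_def[symmetric] by auto
      ultimately have "cmod (poly ?p (- cnj ?x)) \<le> cmod (poly ?p ?x)"
        by (rule poly_norm_reflect_le)
      \<comment> \<open>The scaling factor is real, so it commutes with the reflection.\<close>
      then have "cmod (F (- cnj \<mu>) n) \<le> cmod (F \<mu> n)"
        by (simp add: F_def norm_divide divide_right_mono)
      then show False using elim by simp
    qed
  qed
  then show ?thesis
    using eventually_sequentially_Suc[of "\<lambda>n. \<not> linearly_stable (M n)"] by blast
qed

end

end

theorem theorem2p1:
  fixes gx gv \<rho>xp \<rho>xm \<rho>vp \<rho>vm :: "nat \<Rightarrow> real"
  assumes "\<forall>i\<in>{1, 2, 3}. \<rho>xp i + \<rho>xm i = -1"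
    and "\<forall>i\<in>{1, 2, 3}. \<rho>vp i + \<rho>vm i = -1"
    and "(gx 1 = 0 \<or> gx 2 = 0 \<or> gx 3 = 0)
      \<or> (\<Sum>i\<in>{1, 2, 3}. E_term (gx i) (gx (next3 i)) (\<rho>xp i) (\<rho>xp (next3 i))) = 0
      \<or> gx 1 * gx 2 * gx 3 *
          ((\<Sum>i\<in>{1, 2, 3}. beta \<rho>xp \<rho>xm i) + (\<Prod>i\<in>{1, 2, 3}. beta \<rho>xp \<rho>xm i)) \<noteq> 0"
  shows "\<forall>\<^sub>F n in sequentially. \<not> linearly_stable (system_matrix gx gv \<rho>xp \<rho>xm \<rho>vp \<rho>vm n)"
proof -
  note \<rho>x = assms(1) and \<rho>v = assms(2)
  let ?stable = "\<lambda>n. linearly_stable (system_matrix gx gv \<rho>xp \<rho>xm \<rho>vp \<rho>vm n)"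
  let ?E = "\<Sum>i\<in>{1, 2, 3}. E_term (gx i) (gx (next3 i)) (\<rho>xp i) (\<rho>xp (next3 i))"
  \<comment> \<open>The long-wave argument needs nonzero curvature, so the third condition is
    treated only when the \<open>E\<close> sum is nonzero.\<close>
  consider "gx 1 = 0 \<or> gx 2 = 0 \<or> gx 3 = 0" | "?E = 0"
    | "?E \<noteq> 0" "gx 1 * gx 2 * gx 3 * (4 * (\<rho>xp 1 * \<rho>xp 2 * \<rho>xp 3 - \<rho>xm 1 * \<rho>xm 2 * \<rho>xm 3)) \<noteq> 0"
    using assms(3) unfolding beta_sum_prod_eq[OF \<rho>x] by blast
  then show ?thesis
  proof cases
    case 1
    then have "\<not> ?stable n" if "n \<ge> 2" for n
      using not_stable_if_gx_zero[OF \<rho>x \<rho>v _ that] by blast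
    then show ?thesis unfolding eventually_sequentially by blast
  next
    case 2
    then have "\<not> ?stable n" if "n \<ge> 1" for n
      using not_stable_if_E_sum_zero[OF \<rho>x \<rho>v, of gx n gv] that by linarith
    then show ?thesis unfolding eventually_sequentially by blast
  next
    case 3
    then show ?thesis
      by (intro eventually_not_stable[OF \<rho>x \<rho>v]) (auto simp: curvature_def drift_def)
  qed
qed

end
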